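(* Let $n$ and $D$ be positive integers such that $D\le n/2$. If an algorithm $A$ solves treasure hunting in $O(D)$ rounds whenever the treasure is at distance $D$ from the initial position of the agent, then there exists an $n$-node graph $G$ with the treasure at distance $D$ from the initial position of the agent such that $A$ requires $\Omega(D\log(n/D))$ bits of advice.
   Context: Treasure hunt: a single mobile agent starts at a node of an undirected connected graph whose nodes are unlabeled; at each node $v$ of degree $d$ the incident edges carry distinct port numbers $0,\dots,d-1$ (local numbering). The agent moves in synchronous rounds, in each round either staying or taking a chosen port to an adjacent node; on entering a node it learns the node's degree and the port by which it entered. It cannot mark nodes. It must reach a stationary target (the treasure) at an unknown node and recognizes it upon arrival. The agent runs a deterministic algorithm that receives an advice binary string from an oracle knowing the whole instance (graph with port numbering, initial position, treasure location); the size of advice is the length of this string. The running time is the number of rounds until the agent reaches the treasure. *)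

theory Defs
  imports Complex_Main "Graph_Theory.Graph_Theory"
begin

text \<open>
  An instance is what the oracle sees: a port-numbered graph, the initial position of the agent and
  the location of the treasure. \<open>port I v u\<close> is the port number at \<open>v\<close> of the edge joining \<open>v\<close> to \<open>u\<close>;
  its values on non-adjacent pairs are irrelevant. The names of the nodes are never shown to the
  agent.
\<close>

record hunt_instance =
  graph :: "nat pair_pre_digraph"
  port :: "nat \<Rightarrow> nat \<Rightarrow> nat"
  start :: nat
  treasure :: nat

definition neighbours :: "hunt_instance \<Rightarrow> nat \<Rightarrow> nat set" where
  "neighbours I v = {u. (v, u) \<in> parcs (graph I)}"

definition degree :: "hunt_instance \<Rightarrow> nat \<Rightarrow> nat" where
  "degree I v = card (neighbours I v)"

text \<open>The locale \<open>pair_graph\<close> describes finite simple undirected graphs, every edge being represented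
  by its two orientations.\<close>

definition valid_instance :: "hunt_instance \<Rightarrow> bool" where
  "valid_instance I \<longleftrightarrow>
     pair_graph (graph I) \<and>
     connected (with_proj (graph I)) \<and>
     (\<forall>v \<in> pverts (graph I). bij_betw (port I v) (neighbours I v) {..<degree I v}) \<and>
     start I \<in> pverts (graph I) \<and>
     treasure I \<in> pverts (graph I)"

definition num_nodes :: "hunt_instance \<Rightarrow> nat" where
  "num_nodes I = card (pverts (graph I))"

definition treasure_distance :: "hunt_instance \<Rightarrow> ereal" where
  "treasure_distance I =
     wf_digraph.\<mu> (with_proj (graph I)) (\<lambda>_. 1) (start I) (treasure I)"

definition neighbour_via :: "hunt_instance \<Rightarrow> nat \<Rightarrow> nat \<Rightarrow> nat" where
  "neighbour_via I v p = (THE u. u \<in> neighbours I v \<and> port I v u = p)"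

text \<open>
  What the agent perceives at the beginning of a round: the degree of its current node and, if it
  has just entered the node, the port of entry (\<open>None\<close> in the first round and after a round in which
  it stayed).
\<close>

type_synonym observation = "nat \<times> nat option"

text \<open>
  A deterministic algorithm maps the advice and all observations so far (oldest first) to a decision:
  \<open>None\<close> is to stay, \<open>Some p\<close> is to take port \<open>p\<close>. The agent's own past decisions are determined by
  these data.
\<close>

type_synonym algorithm = "bool list \<Rightarrow> observation list \<Rightarrow> nat option"

type_synonym oracle_fun = "hunt_instance \<Rightarrow> bool list"

text \<open>One round. Choosing a port number that does not exist at the current node means staying.\<close>

definition move :: "hunt_instance \<Rightarrow> nat \<Rightarrow> nat option \<Rightarrow> nat \<times> observation" where
  "move I v a =
     (case a of
        None \<Rightarrow> (v, (degree I v, None))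
      | Some p \<Rightarrow>
          if p < degree I v
          then (let u = neighbour_via I v p in (u, (degree I u, Some (port I u v))))
          else (v, (degree I v, None)))"

primrec config :: "algorithm \<Rightarrow> bool list \<Rightarrow> hunt_instance \<Rightarrow> nat \<Rightarrow> nat \<times> observation list" where
  "config A s I 0 = (start I, [(degree I (start I), None)])"
| "config A s I (Suc t) =
     (let (v, h) = config A s I t; (u, ob) = move I v (A s h) in (u, h @ [ob]))"

definition position :: "algorithm \<Rightarrow> bool list \<Rightarrow> hunt_instance \<Rightarrow> nat \<Rightarrow> nat" where
  "position A s I t = fst (config A s I t)"

text \<open>The agent recognises the treasure on arrival, so the hunt ends with the first visit and only
  the walk before that visit matters.\<close>

definition running_time_le :: "algorithm \<Rightarrow> bool list \<Rightarrow> hunt_instance \<Rightarrow> real \<Rightarrow> bool" where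
  "running_time_le A s I T \<longleftrightarrow> (\<exists>t. real t \<le> T \<and> position A s I t = treasure I)"

definition solves_hunt :: "algorithm \<Rightarrow> oracle_fun \<Rightarrow> nat \<Rightarrow> real \<Rightarrow> bool" where
  "solves_hunt A orc D T \<longleftrightarrow>
     (\<forall>I. valid_instance I \<longrightarrow> treasure_distance I = ereal (real D) \<longrightarrow>
        running_time_le A (orc I) I T)"

end

theory Submission
  imports Defs "HOL-Library.Countable"
begin

text \<open>
  The hard instances are chains of \<open>B = \<Theta>(D)\<close> gadgets. A gadget is a complete bipartite graph with
  parts of sizes \<open>q\<close> and \<open>r\<close>, one of whose edges is subdivided by the node from which the chain
  goes on. Subdividing changes no degree of an old node, so until the agent traverses the subdivided edge
  it cannot tell which edge that is. Hence, for fixed advice, the set of rounds in which a new gadget is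
  entered determines all subdivided edges, and within \<open>T = O(B)\<close> rounds a fixed advice string solves
  at most \<open>O(1)\<^sup>B\<close> of the \<open>N\<^sup>B\<close> instances, where \<open>N\<close> is the number of edges that may be subdivided.
  So some instance needs about \<open>B log N\<close> bits. For large \<open>n / D\<close> the gadgets are stars (\<open>q = 1\<close>) with
  \<open>r\<close> about \<open>n / D\<close>. Otherwise \<open>q = r = g\<close> is a constant so large that the \<open>\<Theta>(g\<^sup>2)\<close> edges of a gadget
  cannot be searched in \<open>O(g)\<close> rounds, and gadgets are joined by paths of length about \<open>2g\<close>, so that
  \<open>n\<close> nodes suffice even if \<open>n = 2D\<close>.
\<close>

section \<open>Instances given by rotation maps\<close>

text \<open>\<open>rot (v, p) = (u, p')\<close> means that port \<open>p\<close> at \<open>v\<close>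
  leads to \<open>u\<close>, entered there by port \<open>p'\<close>. Restating \<open>move\<close>
  and \<open>config\<close> for rotation maps over any vertex type keeps node encodings and the
  \<open>THE\<close> of \<open>neighbour_via\<close> out of the combinatorics.\<close>

definition agent_step ::
  "('v \<Rightarrow> nat) \<Rightarrow> ('v \<times> nat \<Rightarrow> 'v \<times> nat) \<Rightarrow> 'v \<Rightarrow> nat option \<Rightarrow> 'v \<times> observation" where
  "agent_step deg rot v a =
     (case a of
        None \<Rightarrow> (v, (deg v, None))
      | Some p \<Rightarrow>
          if p < deg v
          then (let (u, p') = rot (v, p) in (u, (deg u, Some p')))
          else (v, (deg v, None)))"

primrec agent_run ::
  "('v \<Rightarrow> nat) \<Rightarrow> ('v \<times> nat \<Rightarrow> 'v \<times> nat) \<Rightarrow> 'v \<Rightarrow> (observation list \<Rightarrow> nat option) \<Rightarrow> nat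
    \<Rightarrow> 'v \<times> observation list" where
  "agent_run deg rot s0 f 0 = (s0, [(deg s0, None)])"
| "agent_run deg rot s0 f (Suc t) =
     (let (v, h) = agent_run deg rot s0 f t; (u, ob) = agent_step deg rot v (f h) in (u, h @ [ob]))"

locale rotation_system =
  fixes V :: "'v::countable set"
    and deg :: "'v \<Rightarrow> nat"
    and rot :: "'v \<times> nat \<Rightarrow> 'v \<times> nat"
    and source target :: 'v
  assumes finite_V: "finite V"
    and rot_closed: "\<And>v p u p'. \<lbrakk>v \<in> V; p < deg v; rot (v, p) = (u, p')\<rbrakk> \<Longrightarrow> u \<in> V \<and> p' < deg u"
    and rot_rot: "\<And>v p. \<lbrakk>v \<in> V; p < deg v\<rbrakk> \<Longrightarrow> rot (rot (v, p)) = (v, p)"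
    and rot_loopfree: "\<And>v p. \<lbrakk>v \<in> V; p < deg v\<rbrakk> \<Longrightarrow> fst (rot (v, p)) \<noteq> v"
    and rot_simple: "\<And>v. v \<in> V \<Longrightarrow> inj_on (\<lambda>p. fst (rot (v, p))) {..<deg v}"
    and source_in_V: "source \<in> V"
    and target_in_V: "target \<in> V"
begin

definition nbr :: "'v \<Rightarrow> nat \<Rightarrow> 'v" where
  "nbr v p = fst (rot (v, p))"

definition hunt :: hunt_instance where
  "hunt = \<lparr>graph = \<lparr>pverts = to_nat ` V,
                    parcs = {(to_nat v, to_nat (nbr v p)) | v p. v \<in> V \<and> p < deg v}\<rparr>,
           port = \<lambda>a b. THE p. p < deg (from_nat a) \<and> to_nat (nbr (from_nat a) p) = b,
           start = to_nat source,
           treasure = to_nat target\<rparr>"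

lemma hunt_simps [simp]:
  "pverts (graph hunt) = to_nat ` V"
  "parcs (graph hunt) = {(to_nat v, to_nat (nbr v p)) | v p. v \<in> V \<and> p < deg v}"
  "start hunt = to_nat source"
  "treasure hunt = to_nat target"
  by (simp_all add: hunt_def)

lemma nbr_inj: "\<lbrakk>v \<in> V; p < deg v; p' < deg v; nbr v p = nbr v p'\<rbrakk> \<Longrightarrow> p = p'"
  using rot_simple[of v] unfolding inj_on_def nbr_def by auto

lemma nbr_in_V: "\<lbrakk>v \<in> V; p < deg v\<rbrakk> \<Longrightarrow> nbr v p \<in> V"
  using rot_closed[of v p "fst (rot (v, p))" "snd (rot (v, p))"] by (simp add: nbr_def)

lemma neighbours_hunt:
  assumes "v \<in> V"
  shows "neighbours hunt (to_nat v) = (\<lambda>p. to_nat (nbr v p)) ` {..<deg v}"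
  using assms by (auto simp: neighbours_def)

lemma degree_hunt:
  assumes "v \<in> V"
  shows "degree hunt (to_nat v) = deg v"
proof -
  have "inj_on (\<lambda>p. to_nat (nbr v p)) {..<deg v}"
    using nbr_inj[OF assms] by (auto simp: inj_on_def)
  then show ?thesis
    by (simp add: degree_def neighbours_hunt[OF assms] card_image)
qed

lemma port_hunt:
  assumes "v \<in> V" "p < deg v"
  shows "port hunt (to_nat v) (to_nat (nbr v p)) = p"
  using assms nbr_inj[OF assms(1)] by (auto simp: hunt_def intro!: the_equality)

lemma port_hunt_back:
  assumes "v \<in> V" "p < deg v"
  shows "port hunt (to_nat (nbr v p)) (to_nat v) = snd (rot (v, p))"
proof -
  obtain u p' where rot: "rot (v, p) = (u, p')" by force
  have "u \<in> V" "p' < deg u" using rot_closed[OF assms rot] by auto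
  moreover have "nbr u p' = v" using rot_rot[OF assms] rot by (simp add: nbr_def)
  ultimately show ?thesis using port_hunt[of u p'] rot by (simp add: nbr_def)
qed

lemma bij_betw_port_hunt:
  assumes "v \<in> V"
  shows "bij_betw (port hunt (to_nat v)) (neighbours hunt (to_nat v)) {..<degree hunt (to_nat v)}"
  unfolding neighbours_hunt[OF assms] degree_hunt[OF assms]
  by (rule bij_betw_byWitness[where f' = "\<lambda>p. to_nat (nbr v p)"])
    (auto simp: port_hunt[OF assms])

lemma neighbour_via_hunt:
  assumes "v \<in> V" "p < deg v"
  shows "neighbour_via hunt (to_nat v) p = to_nat (nbr v p)"
  unfolding neighbour_via_def neighbours_hunt[OF assms(1)]
proof (rule the_equality)
  fix u
  assume "u \<in> (\<lambda>p. to_nat (nbr v p)) ` {..<deg v} \<and> port hunt (to_nat v) u = p"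
  then show "u = to_nat (nbr v p)"
    using port_hunt[OF assms(1)] by auto
qed (use assms port_hunt[OF assms] in auto)

lemma agent_step_in_V: "v \<in> V \<Longrightarrow> fst (agent_step deg rot v a) \<in> V"
  using nbr_in_V by (simp add: agent_step_def nbr_def split: option.split prod.split) (metis fst_conv)

lemma move_hunt:
  assumes "v \<in> V"
  shows "move hunt (to_nat v) a = map_prod to_nat id (agent_step deg rot v a)"
proof (cases a)
  case None
  then show ?thesis using assms by (simp add: move_def agent_step_def degree_hunt)
next
  case (Some p)
  show ?thesis
  proof (cases "p < deg v")
    case True
    then show ?thesis
      using Some assms nbr_in_V[OF assms True]
      by (simp add: move_def agent_step_def degree_hunt neighbour_via_hunt port_hunt_back Let_def
          split_beta flip: nbr_def)
  next
    case False
    then show ?thesis using Some assms by (simp add: move_def agent_step_def degree_hunt)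
  qed
qed

text \<open>Both claims go through one induction, because \<open>move_hunt\<close> applies only at
  nodes of \<open>V\<close>.\<close>

lemma config_hunt:
  "fst (agent_run deg rot source (A s) t) \<in> V \<and>
   config A s hunt t = map_prod to_nat id (agent_run deg rot source (A s) t)"
proof (induction t)
  case 0
  then show ?case using source_in_V by (simp add: degree_hunt)
next
  case (Suc t)
  then show ?case
    using agent_step_in_V by (auto simp: move_hunt split_beta)
qed

lemma position_hunt:
  "position A s hunt t = treasure hunt \<longleftrightarrow> fst (agent_run deg rot source (A s) t) = target"
  using config_hunt[of A s t] by (simp add: position_def)

lemma num_nodes_hunt: "num_nodes hunt = card V"
  by (simp add: num_nodes_def card_image)

lemma pair_graph_hunt: "pair_graph (graph hunt)"
proof unfold_locales
  have "parcs (graph hunt) \<subseteq> to_nat ` V \<times> to_nat ` V" using nbr_in_V by auto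
  then show "finite (parcs (graph hunt))"
    using finite_V by (meson finite_SigmaI finite_imageI finite_subset)
  have "(b, a) \<in> parcs (graph hunt)" if "(a, b) \<in> parcs (graph hunt)" for a b
  proof -
    from that obtain v p where v: "v \<in> V" "p < deg v" "a = to_nat v" "b = to_nat (nbr v p)" by auto
    obtain u p' where rot: "rot (v, p) = (u, p')" by force
    have "u \<in> V" "p' < deg u" using rot_closed[OF v(1,2) rot] by auto
    moreover have "nbr u p' = v" "nbr v p = u" using rot_rot[OF v(1,2)] rot by (simp_all add: nbr_def)
    ultimately show ?thesis using v by force
  qed
  then show "symmetric (with_proj (graph hunt))"
    unfolding symmetric_def with_proj_simps by (blast intro: symI)
  show "fst e \<noteq> snd e" if "e \<in> parcs (graph hunt)" for e
    using that rot_loopfree by (auto simp: nbr_def) metis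
qed (use finite_V nbr_in_V in auto)

end

section \<open>Distances from the source\<close>

text \<open>The assumptions force \<open>level\<close> to be the distance from
  \<open>source\<close>: \<open>level_nbr\<close> bounds distances from below, and
  \<open>level_descent\<close> from above. Descent also yields connectedness.\<close>

locale levelled_rotation_system = rotation_system +
  fixes level :: "'a \<Rightarrow> nat"
  assumes level_source: "level source = 0"
    and level_nbr: "\<And>v p. \<lbrakk>v \<in> V; p < deg v\<rbrakk> \<Longrightarrow> level (fst (rot (v, p))) \<le> Suc (level v)"
    and level_descent:
      "\<And>v. \<lbrakk>v \<in> V; v \<noteq> source\<rbrakk> \<Longrightarrow> \<exists>p < deg v. level (fst (rot (v, p))) < level v"
begin

interpretation pair_graph "graph hunt"
  by (rule pair_graph_hunt)

lemma exists_awalk: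
  assumes "v \<in> V"
  shows "\<exists>w. awalk (to_nat source) w (to_nat v) \<and> length w \<le> level v"
  using assms
proof (induction "level v" arbitrary: v rule: less_induct)
  case less
  show ?case
  proof (cases "v = source")
    case True
    then show ?thesis using source_in_V by (intro exI[of _ "[]"]) (simp add: awalk_Nil_iff)
  next
    case False
    then obtain p where p: "p < deg v" "level (nbr v p) < level v"
      using level_descent less.prems by (auto simp: nbr_def)
    then obtain w where w: "awalk (to_nat source) w (to_nat (nbr v p))" "length w \<le> level (nbr v p)"
      using less.hyps[OF p(2)] nbr_in_V less.prems by blast
    have "(to_nat v, to_nat (nbr v p)) \<in> parcs (graph hunt)" using p less.prems by auto
    then have arc: "(to_nat (nbr v p), to_nat v) \<in> parcs (graph hunt)" by (rule arcs_symmetric)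
    then have "awalk (to_nat (nbr v p)) [(to_nat (nbr v p), to_nat v)] (to_nat v)"
      using arc_implies_awalk[of "(to_nat (nbr v p), to_nat v)"] by (simp del: hunt_simps)
    then have "awalk (to_nat source) (w @ [(to_nat (nbr v p), to_nat v)]) (to_nat v)"
      using w(1) by (rule awalk_appendI[rotated])
    moreover have "length (w @ [(to_nat (nbr v p), to_nat v)]) \<le> level v"
      using w(2) p(2) by simp
    ultimately show ?thesis by blast
  qed
qed

lemma awalk_level:
  assumes "awalk (to_nat u) w (to_nat v)"
  shows "level v \<le> level u + length w"
  using assms
proof (induction w arbitrary: u)
  case Nil
  then show ?case by (simp add: awalk_Nil_iff)
next
  case (Cons e w)
  then have e: "e \<in> parcs (graph hunt)" "fst e = to_nat u" "awalk (snd e) w (to_nat v)"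
    by (auto simp: awalk_Cons_iff)
  then obtain p where p: "u \<in> V" "p < deg u" "snd e = to_nat (nbr u p)" by auto
  then show ?case using Cons.IH[of "nbr u p"] e(3) level_nbr[of u p] by (simp add: nbr_def)
qed

lemma valid_instance_hunt: "valid_instance hunt"
proof -
  have reach: "(to_nat u) \<rightarrow>\<^sup>*\<^bsub>with_proj (graph hunt)\<^esub> (to_nat v)" if "u \<in> V" "v \<in> V" for u v
  proof -
    have from_source: "(to_nat source) \<rightarrow>\<^sup>*\<^bsub>with_proj (graph hunt)\<^esub> (to_nat x)" if "x \<in> V" for x
      using exists_awalk[OF that] by (auto simp: reachable_awalk)
    show ?thesis using from_source[OF that(1)] from_source[OF that(2)]
      by (metis reachable_trans symmetric_reachable pair_sym_arcs)
  qed
  then have "(a, b) \<in> rtrancl_on (pverts (graph hunt)) ((parcs (graph hunt))\<^sup>s)"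
    if "a \<in> pverts (graph hunt)" "b \<in> pverts (graph hunt)" for a b
  proof -
    have "(a, b) \<in> rtrancl_on (pverts (graph hunt)) (parcs (graph hunt))"
      using that reach by (auto simp: reachable_def simp del: hunt_simps(2))
    then show ?thesis by (rule rtrancl_on_mono[rotated 2]) (auto simp: symcl_def)
  qed
  then have "connected (with_proj (graph hunt))"
    using source_in_V by (auto simp: connected_conv simp del: hunt_simps(2))
  then show ?thesis
    unfolding valid_instance_def
    using pair_graph_hunt bij_betw_port_hunt source_in_V target_in_V by auto
qed

lemma treasure_distance_hunt: "treasure_distance hunt = ereal (real (level target))"
proof -
  have cost: "awalk_cost (\<lambda>_. 1) w = real (length w)" for w :: "(nat \<times> nat) list"
    by (simp add: awalk_cost_def sum_list_triv)
  obtain w where w: "awalk (to_nat source) w (to_nat target)" "length w \<le> level target"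
    using exists_awalk target_in_V by blast
  have "\<mu> (\<lambda>_. 1) (to_nat source) (to_nat target) \<le> ereal (real (level target))"
    using min_cost_le_walk_cost[OF w(1), of "\<lambda>_. 1"] w(2) by (auto simp: cost elim: order_trans)
  moreover have "\<mu> (\<lambda>_. 1) (to_nat source) (to_nat target) \<ge> ereal (real (level target))"
    unfolding \<mu>_def using awalk_level[of source _ target]
    by (intro INF_greatest) (auto simp: cost level_source)
  ultimately show ?thesis
    unfolding treasure_distance_def hunt_simps by (rule antisym)
qed

end

section \<open>Counting the instances solved with fixed advice\<close>

text \<open>A parameter \<open>x\<close> has one coordinate per gadget, and \<open>idx v\<close> is
  the gadget of \<open>v\<close>. Degrees are the same for all parameters; rotations reveal
  coordinate \<open>idx v\<close> only at a dart leading to gadget \<open>Suc (idx v)\<close>, which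
  the last three assumptions make precise.\<close>

locale hunt_family =
  fixes V :: "'v set"
    and deg :: "'v \<Rightarrow> nat"
    and rot :: "(nat \<Rightarrow> 'c) \<Rightarrow> 'v \<times> nat \<Rightarrow> 'v \<times> nat"
    and source target :: 'v
    and X :: "(nat \<Rightarrow> 'c) set"
    and B :: nat
    and idx :: "'v \<Rightarrow> nat"
  assumes source_in: "source \<in> V"
    and rot_in: "\<And>x v p. \<lbrakk>x \<in> X; v \<in> V; p < deg v\<rbrakk> \<Longrightarrow> fst (rot x (v, p)) \<in> V"
    and finite_X: "finite X"
    and X_extensional: "X \<subseteq> extensional {..<B}"
    and idx_source: "idx source = 0"
    and idx_target: "idx target = B"
    and idx_le: "\<And>v. v \<in> V \<Longrightarrow> idx v \<le> B"
    and idx_rot: "\<And>x v p. \<lbrakk>x \<in> X; v \<in> V; p < deg v\<rbrakk> \<Longrightarrow> idx (fst (rot x (v, p))) \<le> Suc (idx v)"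
    and exit_determines:
      "\<And>x y v p. \<lbrakk>x \<in> X; y \<in> X; v \<in> V; p < deg v;
         idx v < idx (fst (rot x (v, p))); idx v < idx (fst (rot y (v, p)))\<rbrakk> \<Longrightarrow> x (idx v) = y (idx v)"
    and rot_eq_if_no_exit:
      "\<And>x y v p. \<lbrakk>x \<in> X; y \<in> X; v \<in> V; p < deg v; \<forall>i < idx v. x i = y i;
         idx (fst (rot x (v, p))) \<le> idx v; idx (fst (rot y (v, p))) \<le> idx v\<rbrakk>
       \<Longrightarrow> rot x (v, p) = rot y (v, p)"
    and rot_eq_if_agree:
      "\<And>x y v p. \<lbrakk>x \<in> X; y \<in> X; v \<in> V; p < deg v; \<forall>i \<le> idx v. x i = y i\<rbrakk>
       \<Longrightarrow> rot x (v, p) = rot y (v, p)"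
begin

abbreviation run :: "(nat \<Rightarrow> 'c) \<Rightarrow> (observation list \<Rightarrow> nat option) \<Rightarrow> nat \<Rightarrow> 'v \<times> observation list" where
  "run x f \<equiv> agent_run deg (rot x) source f"

text \<open>A running maximum, since the agent may walk back: only first entries into gadgets are to
  count.\<close>

primrec progress :: "(nat \<Rightarrow> 'c) \<Rightarrow> (observation list \<Rightarrow> nat option) \<Rightarrow> nat \<Rightarrow> nat" where
  "progress x f 0 = 0"
| "progress x f (Suc t) = max (progress x f t) (idx (fst (run x f (Suc t))))"

definition exit_times :: "(nat \<Rightarrow> 'c) \<Rightarrow> (observation list \<Rightarrow> nat option) \<Rightarrow> nat \<Rightarrow> nat set" where
  "exit_times x f T = {t. t < T \<and> progress x f t < progress x f (Suc t)}"

lemma run_in_V: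
  assumes "x \<in> X"
  shows "fst (run x f t) \<in> V"
proof (induction t)
  case 0
  then show ?case using source_in by simp
next
  case (Suc t)
  then show ?case
    using rot_in[OF assms] by (simp add: split_beta agent_step_def split: option.split)
qed

lemma idx_le_progress: "idx (fst (run x f t)) \<le> progress x f t"
  by (cases t) (simp_all add: idx_source)

lemma progress_le:
  assumes "x \<in> X"
  shows "progress x f t \<le> B"
  by (induction t) (use idx_le run_in_V[OF assms] in \<open>auto simp del: agent_run.simps\<close>)

lemma progress_mono: "t \<le> t' \<Longrightarrow> progress x f t \<le> progress x f t'"
  by (rule lift_Suc_mono_le[of "progress x f"]) auto

lemma card_exit_times:
  assumes "x \<in> X"
  shows "card (exit_times x f T) \<le> B"
proof -
  \<comment> \<open>Every exit time raises \<open>progress\<close> by at least one, so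
    \<open>progress\<close> at \<open>T\<close> is the bound that can be proved by
    induction.\<close>
  have "card (exit_times x f T) \<le> progress x f T"
  proof (induction T)
    case 0
    then show ?case by (simp add: exit_times_def)
  next
    case (Suc T)
    have "exit_times x f (Suc T) =
        (if progress x f T < progress x f (Suc T) then insert T (exit_times x f T) else exit_times x f T)"
      unfolding exit_times_def by (auto simp: less_Suc_eq simp del: progress.simps)
    moreover have "T \<notin> exit_times x f T" "finite (exit_times x f T)" by (auto simp: exit_times_def)
    ultimately show ?case
      using Suc.IH progress_mono[of T "Suc T" x f] by (simp del: progress.simps)
  qed
  then show ?thesis using progress_le[OF assms] order_trans by blast
qed

text \<open>As long as the agent meets no exit of a new gadget, what it sees depends only on the gadgets it
  has already passed; and the round in which it does find the exit reveals which one it is.\<close>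

lemma run_eq_if_exit_times_eq:
  assumes x: "x \<in> X" and y: "y \<in> X" and eq: "exit_times x f T = exit_times y f T" and "t \<le> T"
  shows "run x f t = run y f t \<and> progress x f t = progress y f t \<and>
         (\<forall>i < progress x f t. x i = y i)"
  using \<open>t \<le> T\<close>
proof (induction t)
  case 0
  then show ?case by simp
next
  case (Suc t)
  obtain v hist where vh: "run x f t = (v, hist)" by force
  have IH: "run y f t = (v, hist)" "progress y f t = progress x f t"
    "\<And>i. i < progress x f t \<Longrightarrow> x i = y i"
    using Suc vh by auto
  have v: "v \<in> V" "idx v \<le> progress x f t"
    using run_in_V[OF x, of f t] idx_le_progress[of x f t] vh by auto
  \<comment> \<open>As the sets of exit times coincide, round \<open>t\<close> opens a new gadget in
    both runs or in neither.\<close>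
  have exit_iff: "progress x f t < progress x f (Suc t) \<longleftrightarrow> progress x f t < progress y f (Suc t)"
  proof -
    have "t \<in> exit_times x f T \<longleftrightarrow> t \<in> exit_times y f T" using eq by simp
    then show ?thesis using Suc.prems IH(2) by (simp add: exit_times_def del: progress.simps)
  qed
  show ?case
  proof (cases "\<exists>p. f hist = Some p \<and> p < deg v")
    case False
    then have "agent_step deg (rot w) v (f hist) = (v, (deg v, None))" for w
      by (cases "f hist") (auto simp: agent_step_def)
    then show ?thesis using vh IH v by auto
  next
    case True
    then obtain p where p: "f hist = Some p" "p < deg v" by blast
    have run_Suc: "run w f (Suc t) = (fst (rot w (v, p)),
        hist @ [(deg (fst (rot w (v, p))), Some (snd (rot w (v, p))))])" if "run w f t = (v, hist)" for w
      using that p by (simp add: agent_step_def split_beta)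
    have prog_Suc: "progress w f (Suc t) = max (progress x f t) (idx (fst (rot w (v, p))))"
      if "run w f t = (v, hist)" "progress w f t = progress x f t" for w
      using run_Suc[OF that(1)] that(2) by simp
    note prog = prog_Suc[OF vh refl] prog_Suc[OF IH(1,2)]
    have le_Suc: "idx (fst (rot x (v, p))) \<le> Suc (idx v)"
      by (rule idx_rot) (use x v p in auto)
    \<comment> \<open>The only coordinate that can be new is \<open>idx v\<close>, when the dart
      leaves the furthest gadget reached. Then it is an exit for \<open>y\<close> as well, and
      \<open>exit_determines\<close> applies.\<close>
    have agree: "x i = y i" if "i < max (progress x f t) (idx (fst (rot x (v, p))))" for i
    proof (cases "i < progress x f t")
      case False
      then have "i = idx v" "idx v = progress x f t" "progress x f t < idx (fst (rot x (v, p)))"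
        using that le_Suc v(2) by auto
      moreover from this have "idx v < idx (fst (rot y (v, p)))"
        using exit_iff unfolding prog by (simp add: less_max_iff_disj)
      ultimately show ?thesis
        using exit_determines[OF x y v(1) p(2)] by simp
    qed (use IH in blast)
    \<comment> \<open>If the coordinates up to \<open>idx v\<close> do not all agree, then
      \<open>v\<close> lies in the furthest gadget reached and, by \<open>agree\<close> and
      \<open>exit_iff\<close>, the dart is an exit for neither parameter.\<close>
    have "rot x (v, p) = rot y (v, p)"
    proof (cases "\<forall>i \<le> idx v. x i = y i")
      case True
      then show ?thesis using rot_eq_if_agree x y v p by blast
    next
      case False
      then have "idx v = progress x f t" using IH(3) v(2) by (metis le_neq_implies_less order_le_less_trans)
      moreover have "\<not> idx v < idx (fst (rot x (v, p)))"
        using False agree by (metis calculation le_less_trans less_max_iff_disj)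
      moreover from calculation have "\<not> idx v < idx (fst (rot y (v, p)))"
        using exit_iff unfolding prog by (simp add: less_max_iff_disj)
      ultimately show ?thesis
        by (intro rot_eq_if_no_exit[OF x y v(1) p(2)]) (auto intro: IH(3))
    qed
    then show ?thesis
      using run_Suc[OF vh] run_Suc[OF IH(1)] prog agree by metis
  qed
qed

definition found :: "(nat \<Rightarrow> 'c) \<Rightarrow> (observation list \<Rightarrow> nat option) \<Rightarrow> nat \<Rightarrow> bool" where
  "found x f T \<longleftrightarrow> (\<exists>t \<le> T. fst (run x f t) = target)"

text \<open>At the target \<open>progress\<close> has reached \<open>B\<close>, so equal exit times
  force all \<open>B\<close> coordinates to agree.\<close>

lemma inj_on_exit_times: "inj_on (\<lambda>x. exit_times x f T) {x \<in> X. found x f T}"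
proof (rule inj_onI)
  fix x y
  assume xy: "x \<in> {x \<in> X. found x f T}" "y \<in> {x \<in> X. found x f T}"
    and eq: "exit_times x f T = exit_times y f T"
  obtain t where t: "t \<le> T" "fst (run x f t) = target" using xy by (auto simp: found_def)
  have "B \<le> progress x f t" using idx_le_progress[of x f t] t(2) idx_target by simp
  then have "x i = y i" if "i < B" for i
    using run_eq_if_exit_times_eq[OF _ _ eq t(1)] xy that by auto
  moreover have "x \<in> extensional {..<B}" "y \<in> extensional {..<B}"
    using xy X_extensional by auto
  ultimately show "x = y" by (auto intro: extensionalityI)
qed

lemma card_found_le:
  "card {x \<in> X. found x f T} \<le> card {S. S \<subseteq> {..<T} \<and> card S \<le> B}"
proof (rule card_inj_on_le[OF inj_on_exit_times])
  show "(\<lambda>x. exit_times x f T) ` {x \<in> X. found x f T} \<subseteq> {S. S \<subseteq> {..<T} \<and> card S \<le> B}"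
    using card_exit_times by (auto simp: exit_times_def)
  show "finite {S. S \<subseteq> {..<T} \<and> card S \<le> B}"
    by (rule finite_subset[of _ "Pow {..<T}"]) auto
qed

end

section \<open>Counting small sets of rounds and short advice strings\<close>

text \<open>Each \<open>S\<close> counted has weight
  \<open>\<tau> ^ B * (1 / \<tau>) ^ card S\<close> at least 1. Over all subsets the weights sum to
  \<open>\<tau> ^ B * (1 + 1 / \<tau>) ^ T\<close>, which is at most
  \<open>\<tau> ^ B * exp (T / \<tau>)\<close>, hence at most
  \<open>(\<tau> * exp 1) ^ B\<close>.\<close>

lemma card_small_subsets_le:
  fixes \<tau> :: real
  assumes "\<tau> \<ge> 1" "real T \<le> \<tau> * real B"
  shows "real (card {S. S \<subseteq> {..<T} \<and> card S \<le> B}) \<le> (3 * \<tau>) ^ B"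
proof -
  let ?F = "{S. S \<subseteq> {..<T} \<and> card S \<le> B}"
  have "real (card ?F) = (\<Sum>S\<in>?F. 1)" by simp
  also have "\<dots> \<le> (\<Sum>S\<in>?F. \<tau> ^ B * (1 / \<tau>) ^ card S)"
    using assms(1) by (intro sum_mono) (auto simp: power_one_over field_simps intro: power_increasing)
  also have "\<dots> \<le> (\<Sum>S\<in>Pow {..<T}. \<tau> ^ B * (1 / \<tau>) ^ card S)"
    using assms(1) by (intro sum_mono2) auto
  also have "\<dots> = \<tau> ^ B * (\<Sum>S\<in>Pow {..<T}. (1 / \<tau>) ^ card S)"
    by (simp add: sum_distrib_left)
  also have "(\<Sum>S\<in>Pow {..<T}. (1 / \<tau>) ^ card S) = (1 / \<tau> + 1) ^ T"
    using prod_add[of "{..<T}" "\<lambda>_. 1 / \<tau>" "\<lambda>_. 1"] by simp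
  also have "(1 / \<tau> + 1) ^ T \<le> exp (1 / \<tau>) ^ T"
    using assms(1) by (intro power_mono) (auto simp: add.commute)
  also have "\<dots> = exp (real T / \<tau>)"
    by (simp flip: exp_of_nat_mult)
  also have "\<dots> \<le> exp (real B)"
    using assms by (simp add: field_simps)
  also have "\<dots> = exp 1 ^ B"
    by (simp flip: exp_of_nat_mult)
  also have "\<dots> \<le> 3 ^ B"
    by (intro power_mono exp_le) auto
  finally show ?thesis
    using assms(1) by (simp add: power_mult_distrib mult.commute mult_left_mono)
qed

lemma finite_short_bool_lists: "finite {s :: bool list. length s < k}"
  using finite_lists_length_le[of "UNIV :: bool set" k] by (rule rev_finite_subset) auto

lemma card_short_bool_lists: "card {s :: bool list. length s < k} < 2 ^ k"
proof (cases k)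
  case (Suc l)
  have "card {s :: bool list. length s < k} = (\<Sum>i\<le>l. 2 ^ i)"
    using card_lists_length_le[of "UNIV :: bool set" l] Suc by (simp add: less_Suc_eq_le)
  also have "\<dots> < 2 ^ k"
    unfolding Suc by (induction l) auto
  finally show ?thesis .
qed simp

text \<open>Pigeonhole: fewer than \<open>2 ^ k\<close> strings are shorter than \<open>k\<close>,
  and each solves at most \<open>(3 * \<tau>) ^ B\<close> parameters.\<close>

lemma (in hunt_family) exists_hard_parameter:
  fixes \<tau> :: real
  assumes "\<tau> \<ge> 1" "real T \<le> \<tau> * real B" "2 ^ k * (3 * \<tau>) ^ B \<le> real (card X)"
  shows "\<exists>x \<in> X. \<forall>s :: bool list. length s < k \<longrightarrow> \<not> found x (A s) T"
proof (rule ccontr)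
  assume "\<not> ?thesis"
  then have "X \<subseteq> (\<Union>s \<in> {s. length s < k}. {x \<in> X. found x (A s) T})" by auto
  then have "card X \<le> card (\<Union>s \<in> {s. length s < k}. {x \<in> X. found x (A s) T})"
    using finite_X finite_short_bool_lists by (intro card_mono) auto
  also have "\<dots> \<le> (\<Sum>s \<in> {s. length s < k}. card {x \<in> X. found x (A s) T})"
    by (rule card_UN_le[OF finite_short_bool_lists])
  finally have "real (card X) \<le> real (\<Sum>s \<in> {s. length s < k}. card {x \<in> X. found x (A s) T})"
    by (rule of_nat_mono)
  also have "\<dots> = (\<Sum>s \<in> {s. length s < k}. real (card {x \<in> X. found x (A s) T}))"
    by simp
  also have "\<dots> \<le> (\<Sum>s \<in> {s :: bool list. length s < k}. (3 * \<tau>) ^ B)"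
    using card_found_le card_small_subsets_le[OF assms(1,2)]
    by (intro sum_mono) (meson of_nat_le_iff order_trans)
  also have "\<dots> = real (card {s :: bool list. length s < k}) * (3 * \<tau>) ^ B" by simp
  also have "\<dots> < 2 ^ k * (3 * \<tau>) ^ B"
  proof (rule mult_strict_right_mono)
    show "real (card {s :: bool list. length s < k}) < 2 ^ k"
      using card_short_bool_lists[of k] by (metis of_nat_less_iff of_nat_numeral of_nat_power)
  qed (use assms(1) in auto)
  finally show False using assms(3) by simp
qed

section \<open>Chains of gadgets\<close>

datatype vertex = Spine nat nat | Left nat nat | Right nat nat | Pendant nat

instance vertex :: countable
  by countable_datatype

text \<open>Only edges at left nodes \<open>p \<ge> h\<close> may be subdivided: if \<open>q \<ge> 2\<close>, then \<open>h = 1\<close> excludes the entry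
  \<open>p = 0\<close>, so that every possible exit is at distance \<open>h + 1\<close> from the entry. The path leading to
  gadget \<open>i\<close> has length \<open>m\<close>, the one behind the last gadget length \<open>e\<close>, and \<open>z\<close> leaves hanging
  from the treasure bring the number of nodes up to \<open>n\<close>.\<close>

locale gadget_chain =
  fixes B m h q r e z :: nat
  assumes hq: "h = 0 \<and> q = 1 \<or> h = 1 \<and> q \<ge> 2" and r: "r \<ge> 2"
begin

definition len :: "nat \<Rightarrow> nat" where
  "len i = (if i < B then m else e)"

text \<open>The forward ports of \<open>Spine i t\<close> are numbered first. Then comes one port
  back along the path or, at \<open>t = 0\<close> and \<open>i > 0\<close>, the two ports to the
  ends of the subdivided edge. If \<open>len i = 0\<close>, the subdividing node is also the entry
  of gadget \<open>i\<close>.\<close>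

definition fwd :: "nat \<Rightarrow> nat \<Rightarrow> nat" where
  "fwd i t = (if t < len i then 1 else if i < B then r else z)"

fun deg :: "vertex \<Rightarrow> nat" where
  "deg (Spine i t) = fwd i t + (if t > 0 then 1 else if i > 0 then 2 else 0)"
| "deg (Left i p) = r"
| "deg (Right i j) = q"
| "deg (Pendant k) = 1"

fun idx :: "vertex \<Rightarrow> nat" where
  "idx (Spine i t) = i"
| "idx (Left i p) = i"
| "idx (Right i j) = i"
| "idx (Pendant k) = B"

definition V :: "vertex set" where
  "V = case_prod Spine ` ({..<B} \<times> {..m}) \<union> Spine B ` {..e} \<union>
       case_prod Left ` ({..<B} \<times> {1..<q}) \<union> case_prod Right ` ({..<B} \<times> {..<r}) \<union>
       Pendant ` {..<z}"

text \<open>The end of the path is the entry of the gadget and serves as its left node 0; hence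
  \<open>V\<close> contains \<open>Left i p\<close> only for positive \<open>p\<close>.\<close>

definition left_node :: "nat \<Rightarrow> nat \<Rightarrow> vertex" where
  "left_node i p = (if p = 0 then Spine i (len i) else Left i p)"

text \<open>\<open>x i = (p, j)\<close> says that the exit of gadget \<open>i\<close> subdivides the edge between \<open>left_node i p\<close> and
  \<open>Right i j\<close>; the subdividing node is \<open>Spine (Suc i) 0\<close>.\<close>

definition rot_left :: "(nat \<Rightarrow> nat \<times> nat) \<Rightarrow> nat \<Rightarrow> nat \<Rightarrow> nat \<Rightarrow> vertex \<times> nat" where
  "rot_left x i p j = (if x i = (p, j) then (Spine (Suc i) 0, fwd (Suc i) 0) else (Right i j, p))"

text \<open>The edge between left node \<open>p\<close> and \<open>Right i j\<close> has port
  \<open>j\<close> on the left and port \<open>p\<close> on the right, subdivided or not, so port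
  numbers do not give the exit away.\<close>

fun rot :: "(nat \<Rightarrow> nat \<times> nat) \<Rightarrow> vertex \<times> nat \<Rightarrow> vertex \<times> nat" where
  "rot x (Spine i t, k) =
     (if k < fwd i t then
        if t < len i then (Spine i (Suc t), fwd i (Suc t))
        else if i < B then rot_left x i 0 k
        else (Pendant k, 0)
      else if t > 0 then (Spine i (t - 1), 0)
      else if k = fwd i t then (left_node (i - 1) (fst (x (i - 1))), snd (x (i - 1)))
      else (Right (i - 1) (snd (x (i - 1))), fst (x (i - 1))))"
| "rot x (Left i p, j) = rot_left x i p j"
| "rot x (Right i j, p) =
     (if x i = (p, j) then (Spine (Suc i) 0, Suc (fwd (Suc i) 0)) else (left_node i p, j))"
| "rot x (Pendant k, p) = (Spine B e, k)"

definition X :: "(nat \<Rightarrow> nat \<times> nat) set" where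
  "X = (\<Pi>\<^sub>E i\<in>{..<B}. {h..<q} \<times> {..<r})"

definition base :: "nat \<Rightarrow> nat" where
  "base i = i * (m + h + 1)"

text \<open>Right nodes are one step from the entry and other left nodes two. The exception is a
  right node whose edge to the entry is subdivided: it is reached through the exit, in two
  steps.\<close>

fun level :: "(nat \<Rightarrow> nat \<times> nat) \<Rightarrow> vertex \<Rightarrow> nat" where
  "level x (Spine i t) = base i + t"
| "level x (Left i p) = base i + len i + 2"
| "level x (Right i j) = base i + len i + (if x i = (0, j) then 2 else 1)"
| "level x (Pendant k) = base B + e + 1"

lemma base_0: "base 0 = 0"
  by (simp add: base_def)

lemma base_Suc: "i < B \<Longrightarrow> base (Suc i) = base i + len i + h + 1"
  by (simp add: base_def len_def)

lemma V_simps [simp]: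
  "Spine i t \<in> V \<longleftrightarrow> i \<le> B \<and> t \<le> len i"
  "Left i p \<in> V \<longleftrightarrow> i < B \<and> 0 < p \<and> p < q"
  "Right i j \<in> V \<longleftrightarrow> i < B \<and> j < r"
  "Pendant k \<in> V \<longleftrightarrow> k < z"
  by (auto simp: V_def len_def)

lemma len_B: "len B = e"
  by (simp add: len_def)

lemma card_V: "card V = B * (m + q + r) + e + 1 + z"
proof -
  let ?S = "case_prod Spine ` ({..<B} \<times> {..m})" and ?T = "Spine B ` {..e}"
  let ?L = "case_prod Left ` ({..<B} \<times> {1..<q})" and ?R = "case_prod Right ` ({..<B} \<times> {..<r})"
  let ?P = "Pendant ` {..<z}"
  have cards: "card ?S = B * (m + 1)" "card ?T = e + 1" "card ?L = B * (q - 1)" "card ?R = B * r"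
    "card ?P = z"
    by (subst card_image; force simp: inj_on_def)+
  have "card V = card (?S \<union> ?T \<union> ?L \<union> ?R) + card ?P"
    unfolding V_def by (rule card_Un_disjoint) auto
  also have "card (?S \<union> ?T \<union> ?L \<union> ?R) = card (?S \<union> ?T \<union> ?L) + card ?R"
    by (rule card_Un_disjoint) auto
  also have "card (?S \<union> ?T \<union> ?L) = card (?S \<union> ?T) + card ?L"
    by (rule card_Un_disjoint) auto
  also have "card (?S \<union> ?T) = card ?S + card ?T"
    by (rule card_Un_disjoint) auto
  finally have "card V = B * (m + 1 + (q - 1) + r) + e + 1 + z"
    unfolding cards by (simp add: algebra_simps)
  also have "m + 1 + (q - 1) + r = m + q + r" using hq by auto
  finally show ?thesis .
qed

lemma finite_V: "finite V"
  by (simp add: V_def)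

lemma finite_X: "finite X"
  by (simp add: X_def finite_PiE)

lemma card_X: "card X = ((q - h) * r) ^ B"
  by (simp add: X_def card_PiE)

lemma X_range:
  assumes "x \<in> X" "i < B"
  obtains p j where "x i = (p, j)" "h \<le> p" "p < q" "j < r"
  using assms by (force simp: X_def PiE_iff)

lemma left_node_simps [simp]:
  "idx (left_node i p) = i"
  "\<lbrakk>i < B; p < q\<rbrakk> \<Longrightarrow> left_node i p \<in> V"
  "\<lbrakk>i < B; j < r\<rbrakk> \<Longrightarrow> j < deg (left_node i p)"
  "\<lbrakk>i < B; j < r\<rbrakk> \<Longrightarrow> rot x (left_node i p, j) = rot_left x i p j"
  "left_node i p = left_node i p' \<longleftrightarrow> p = p'"
  "left_node i p \<noteq> Right k j" "Right k j \<noteq> left_node i p"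
  by (auto simp: left_node_def fwd_def)

lemma left_node_neq_exit [simp]:
  "left_node i p \<noteq> Spine (Suc i) t" "Spine (Suc i) t \<noteq> left_node i p"
  by (simp_all add: left_node_def)

lemma fwd_simps [simp]:
  "t < len i \<Longrightarrow> fwd i t = 1"
  "i < B \<Longrightarrow> fwd i (len i) = r"
  "fwd B (len B) = z"
  "fwd B e = z"
  by (simp_all add: fwd_def len_B)

section \<open>The chains as rotation systems and as a hunt family\<close>

text \<open>The end of a path before a gadget is treated as \<open>left_node i 0\<close>, so its
  forward ports fall under the same case as those of the other left nodes.\<close>

lemma dart_cases [consumes 3, case_names Up Down Last Exit_left Exit_right Left Right Pendant]:
  assumes x: "x \<in> X" and v: "v \<in> V" "p < deg v"
  obtains
    i t where "v = Spine i t" "p = 0" "i \<le> B" "t < len i"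
  | i t where "v = Spine i (Suc t)" "p = fwd i (Suc t)" "i \<le> B" "t < len i"
  | "v = Spine B (len B)" "p < z"
  | i a b where "v = Spine (Suc i) 0" "p = fwd (Suc i) 0" "i < B" "x i = (a, b)"
      "h \<le> a" "a < q" "b < r"
  | i a b where "v = Spine (Suc i) 0" "p = Suc (fwd (Suc i) 0)" "i < B" "x i = (a, b)"
      "h \<le> a" "a < q" "b < r"
  | i a where "v = left_node i a" "i < B" "a < q" "p < r"
  | i j where "v = Right i j" "i < B" "j < r" "p < q"
  | k where "v = Pendant k" "k < z" "p = 0"
proof (cases v)
  case (Spine i t)
  then have i: "i \<le> B" "t \<le> len i" using v by auto
  show ?thesis
  proof (cases "p < fwd i t")
    case True
    consider "t < len i" | "t = len i" "i < B" | "t = len i" "i = B" using i by linarith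
    then show ?thesis
    proof cases
      case 1
      then show ?thesis using that(1) Spine True i by simp
    next
      case 2
      then have "v = left_node i 0" "p < r" "0 < q" using Spine True hq by (auto simp: left_node_def)
      then show ?thesis using that(6) 2 by blast
    next
      case 3
      then show ?thesis using that(3) Spine True by simp
    qed
  next
    case False
    show ?thesis
    proof (cases t)
      case (Suc t')
      then show ?thesis using that(2)[of i t'] Spine False v i by simp
    next
      case 0
      then obtain i' where i': "i = Suc i'" "i' < B"
        using Spine False v i by (cases i) auto
      obtain a b where "x i' = (a, b)" "h \<le> a" "a < q" "b < r" using X_range[OF x i'(2)] .
      moreover have "p = fwd i 0 \<or> p = Suc (fwd i 0)" using 0 Spine False v i' by auto
      ultimately show ?thesis using that(4,5) Spine 0 i' by blast
    qed
  qed
next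
  case (Left i a)
  then show ?thesis using that(6)[of i a] v by (simp add: left_node_def)
next
  case (Right i j)
  then show ?thesis using that(7) v by simp
next
  case (Pendant k)
  then show ?thesis using that(8) v by simp
qed

lemma exit_ge: "\<lbrakk>x \<in> X; i < B; x i = (a, b)\<rbrakk> \<Longrightarrow> h \<le> a"
  by (metis X_range fst_conv)

lemma rot_closed:
  assumes x: "x \<in> X" and v: "v \<in> V" "p < deg v"
  shows "fst (rot x (v, p)) \<in> V \<and> snd (rot x (v, p)) < deg (fst (rot x (v, p)))"
  using assms
  by (cases rule: dart_cases) (auto simp: rot_left_def len_B)

lemma rot_rot:
  assumes x: "x \<in> X" and v: "v \<in> V" "p < deg v"
  shows "rot x (rot x (v, p)) = (v, p)"
  using assms
  by (cases rule: dart_cases) (auto simp: rot_left_def len_B)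

lemma rot_neq:
  assumes x: "x \<in> X" and v: "v \<in> V" "p < deg v"
  shows "fst (rot x (v, p)) \<noteq> v"
  using assms
  by (cases rule: dart_cases) (auto simp: rot_left_def)

lemma rot_simple:
  assumes v: "v \<in> V" "p < deg v" "p' < deg v"
    and eq: "fst (rot x (v, p)) = fst (rot x (v, p'))"
  shows "p = p'"
proof (cases v)
  case (Spine i t)
  then show ?thesis using v eq
    by (auto simp: rot_left_def left_node_def fwd_def split: if_splits)
next
  case (Left i a)
  then show ?thesis using eq by (auto simp: rot_left_def split: if_splits)
next
  case (Right i j)
  then show ?thesis using eq by (auto split: if_splits)
next
  case (Pendant k)
  then show ?thesis using v by auto
qed

lemma idx_rot:
  assumes x: "x \<in> X" and v: "v \<in> V" "p < deg v"
  shows "idx (fst (rot x (v, p))) \<le> Suc (idx v)"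
  using assms
  by (cases rule: dart_cases) (auto simp: rot_left_def)

text \<open>A dart inside gadget \<open>i\<close> names both ends of its edge, so finding that it
  leads to the exit reveals the whole pair \<open>x i\<close>.\<close>

sublocale hunt_family V deg rot "Spine 0 0" "Spine B e" X B idx
proof
  show "Spine 0 0 \<in> V" by simp
  show "finite X" by (rule finite_X)
  show "X \<subseteq> extensional {..<B}" by (auto simp: X_def PiE_def)
  show "idx (Spine 0 0) = 0" "idx (Spine B e) = B" by simp_all
next
  fix v
  assume "v \<in> V"
  then show "idx v \<le> B" by (cases v) auto
next
  fix x v p
  assume *: "x \<in> X" "v \<in> V" "p < deg v"
  then show "fst (rot x (v, p)) \<in> V" using rot_closed by blast
  show "idx (fst (rot x (v, p))) \<le> Suc (idx v)"
    using * by (cases rule: dart_cases) (auto simp: rot_left_def)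
next
  fix x y v p
  assume "x \<in> X" "v \<in> V" "p < deg v"
    and "idx v < idx (fst (rot x (v, p)))" "idx v < idx (fst (rot y (v, p)))"
  then show "x (idx v) = y (idx v)"
    by (cases rule: dart_cases) (auto simp: rot_left_def split: if_splits)
next
  fix x y v p
  assume "x \<in> X" "v \<in> V" "p < deg v" "\<forall>i < idx v. x i = y i"
    and "idx (fst (rot x (v, p))) \<le> idx v" "idx (fst (rot y (v, p))) \<le> idx v"
  then show "rot x (v, p) = rot y (v, p)"
    by (cases rule: dart_cases) (auto simp: rot_left_def split: if_splits)
next
  fix x y v p
  assume "x \<in> X" "v \<in> V" "p < deg v" "\<forall>i \<le> idx v. x i = y i"
  then show "rot x (v, p) = rot y (v, p)"
    by (cases rule: dart_cases) (auto simp: rot_left_def)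
qed

lemma levelled_rotation_system:
  assumes x: "x \<in> X"
  shows "levelled_rotation_system V deg (rot x) (Spine 0 0) (Spine B e) (level x)"
proof
  show "finite V" by (rule finite_V)
  show "Spine 0 0 \<in> V" "Spine B e \<in> V" by (simp_all add: len_def)
  show "level x (Spine 0 0) = 0" by (simp add: base_0)
next
  fix v p u p'
  assume "v \<in> V" "p < deg v" "rot x (v, p) = (u, p')"
  then show "u \<in> V \<and> p' < deg u" using rot_closed[OF x] by fastforce
next
  fix v p
  assume v: "v \<in> V" "p < deg v"
  then show "rot x (rot x (v, p)) = (v, p)" by (rule rot_rot[OF x])
  show "fst (rot x (v, p)) \<noteq> v" using v by (rule rot_neq[OF x])
  show "level x (fst (rot x (v, p))) \<le> Suc (level x v)"
    using x v hq exit_ge[OF x]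
    by (cases rule: dart_cases) (auto simp: rot_left_def left_node_def base_Suc len_B split: if_splits)
next
  fix v
  assume "v \<in> V"
  then show "inj_on (\<lambda>p. fst (rot x (v, p))) {..<deg v}"
    using rot_simple by (auto intro!: inj_onI)
next
  fix v
  assume v: "v \<in> V" "v \<noteq> Spine 0 0"
  show "\<exists>p < deg v. level x (fst (rot x (v, p))) < level x v"
  proof (cases v)
    case (Spine i t)
    show ?thesis
    proof (cases t)
      case (Suc t')
      then show ?thesis using Spine v by (intro exI[of _ "fwd i t"]) auto
    next
      case 0
      then obtain i' where i': "i = Suc i'" "i' < B" using Spine v by (cases i) auto
      obtain a b where ab: "x i' = (a, b)" "h \<le> a" "a < q" "b < r" using X_range[OF x i'(2)] .
      show ?thesis
      \<comment> \<open>For \<open>a = 0\<close> descend to the entry. Otherwise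
        \<open>h = 1\<close>, the exit is two steps from the entry, and its right neighbour is one
        step closer.\<close>
      proof (cases "a = 0")
        case True
        then show ?thesis using Spine 0 i' ab(1)
          by (intro exI[of _ "fwd i 0"]) (simp add: left_node_def base_Suc)
      next
        case False
        then have "0 < h" using ab hq by auto
        then show ?thesis using False Spine 0 i' ab(1)
          by (intro exI[of _ "Suc (fwd i 0)"]) (simp add: base_Suc)
      qed
    qed
  next
    case (Left i a)
    \<comment> \<open>At most one port of a left node leads to the exit, so port 0 or 1 leads to a
      right node; \<open>r \<ge> 2\<close> is used here.\<close>
    define j where "j = (if x i = (a, 0) then 1 else 0 :: nat)"
    have "x i \<noteq> (a, j)" "j < r" using r by (auto simp: j_def)
    moreover have "x i \<noteq> (0, j)" using exit_ge[OF x, of i 0 j] hq Left v by auto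
    ultimately show ?thesis using Left v
      by (intro exI[of _ j]) (auto simp: rot_left_def)
  next
    case (Right i j)
    then have ij: "i < B" "j < r" using v by auto
    show ?thesis
    proof (cases "x i = (0, j)")
      case True
      then have "h = 0" "0 < q" using X_range[OF x ij(1)] hq by auto
      \<comment> \<open>The only port of \<open>Right i j\<close> now leads to the exit, which is
        adjacent to the entry.\<close>
      then have "base (Suc i) < base i + len i + 2" "0 < q" using base_Suc[OF ij(1)] by auto
      then show ?thesis using Right True
        by (intro exI[of _ 0]) simp
    next
      case False
      then show ?thesis using Right ij hq
        by (intro exI[of _ 0]) (auto simp: left_node_def)
    qed
  next
    case (Pendant k)
    then show ?thesis by (intro exI[of _ 0]) auto
  qed
qed

end

section \<open>The lower bound\<close>

lemma (in gadget_chain) exists_hard_instance: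
  fixes \<tau> :: real
  assumes "\<tau> \<ge> 1" "real T \<le> \<tau> * real B" "2 ^ k * (3 * \<tau>) ^ B \<le> real ((q - h) * r) ^ B"
  shows "\<exists>I. valid_instance I \<and> num_nodes I = B * (m + q + r) + e + 1 + z \<and>
     treasure_distance I = ereal (real (B * (m + h + 1) + e)) \<and>
     (\<forall>s. length s < k \<longrightarrow> (\<forall>t \<le> T. position A s I t \<noteq> treasure I))"
proof -
  have "2 ^ k * (3 * \<tau>) ^ B \<le> real (card X)" using assms(3) by (simp add: card_X)
  from exists_hard_parameter[OF assms(1,2) this, of A] obtain x
    where x: "x \<in> X" "\<And>s. length s < k \<Longrightarrow> \<not> found x (A s) T" by auto
  interpret levelled_rotation_system V deg "rot x" "Spine 0 0" "Spine B e" "level x"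
    by (rule levelled_rotation_system[OF x(1)])
  have "valid_instance hunt" by (rule valid_instance_hunt)
  moreover have "num_nodes hunt = B * (m + q + r) + e + 1 + z"
    by (simp add: num_nodes_hunt card_V)
  moreover have "treasure_distance hunt = ereal (real (B * (m + h + 1) + e))"
    by (simp add: treasure_distance_hunt base_def)
  moreover have "\<forall>s. length s < k \<longrightarrow> (\<forall>t \<le> T. position A s hunt t \<noteq> treasure hunt)"
    using x(2) unfolding position_hunt found_def by blast
  ultimately show ?thesis by blast
qed

text \<open>The instance is fixed before the oracle: it defeats all short strings, whichever oracle
  supplies them.\<close>

lemma (in gadget_chain) exists_instance_requiring_advice:
  fixes C \<tau> a :: real
  assumes \<tau>: "\<tau> \<ge> 1" and D: "D = B * (m + h + 1) + e" and n: "n = B * (m + q + r) + e + 1 + z"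
    and T: "C * real D \<le> \<tau> * real B" and a: "0 \<le> a" "a + 1 \<le> real B * log 2 (real ((q - h) * r) / (3 * \<tau>))"
  shows "\<exists>I. valid_instance I \<and> num_nodes I = n \<and> treasure_distance I = ereal (real D) \<and>
     (\<forall>orc. solves_hunt A orc D (C * real D) \<longrightarrow> a \<le> real (length (orc I)))"
proof -
  \<comment> \<open>Rounding \<open>a\<close> up to \<open>k\<close> costs less than one bit, whence
    \<open>a + 1\<close> in the assumption.\<close>
  define k where "k = nat \<lceil>a\<rceil>"
  define N where "N = real ((q - h) * r)"
  have N: "N > 0" using hq r by (auto simp: N_def)
  have "real k \<le> a + 1" using a(1) by (simp add: k_def)
  have "2 ^ k = 2 powr real k" by (simp add: powr_realpow)
  also have "\<dots> \<le> 2 powr (real B * log 2 (N / (3 * \<tau>)))"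
    using \<open>real k \<le> a + 1\<close> a(2) by (simp add: N_def)
  also have "\<dots> = (2 powr log 2 (N / (3 * \<tau>))) ^ B"
    by (simp add: powr_powr mult.commute flip: powr_realpow)
  also have "\<dots> = (N / (3 * \<tau>)) ^ B"
    using N \<tau> by simp
  finally have "2 ^ k * (3 * \<tau>) ^ B \<le> N ^ B"
    using \<tau> by (simp add: power_divide field_simps)
  moreover have "real (nat \<lfloor>C * real D\<rfloor>) \<le> \<tau> * real B"
  proof (cases "C * real D \<ge> 0")
    case True
    then show ?thesis using T by linarith
  qed (use \<tau> in simp)
  ultimately obtain I where I: "valid_instance I" "num_nodes I = n" "treasure_distance I = ereal (real D)"
    "\<And>s t. \<lbrakk>length s < k; t \<le> nat \<lfloor>C * real D\<rfloor>\<rbrakk> \<Longrightarrow> position A s I t \<noteq> treasure I"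
    using exists_hard_instance[OF \<tau>, of "nat \<lfloor>C * real D\<rfloor>" k A] unfolding D n N_def by metis
  have "a \<le> real (length (orc I))" if "solves_hunt A orc D (C * real D)" for orc
  proof -
    from that I(1,3) obtain t where t: "real t \<le> C * real D" "position A (orc I) I t = treasure I"
      unfolding solves_hunt_def running_time_le_def by blast
    have "t \<le> nat \<lfloor>C * real D\<rfloor>" using t(1) by (simp add: le_nat_floor)
    then have "k \<le> length (orc I)" using I(4) t(2) by (meson not_less)
    then show ?thesis unfolding k_def by linarith
  qed
  then show ?thesis using I(1-3) by blast
qed

section \<open>Choice of parameters in the two regimes\<close>

lemma exists_instance_sparse:
  fixes C c :: real
  assumes c: "c \<ge> 1" "C \<le> c" and D: "D > 0" and nD: "36 * c\<^sup>2 * real D \<le> real n"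
  shows "\<exists>I. valid_instance I \<and> num_nodes I = n \<and> treasure_distance I = ereal (real D) \<and>
     (\<forall>orc. solves_hunt A orc D (C * real D) \<longrightarrow>
        real D * log 2 (real n / real D) / 4 \<le> real (length (orc I)))"
proof -
  define y where "y = real n / real D"
  have y: "36 * c\<^sup>2 \<le> y" using nD D by (simp add: y_def field_simps)
  have "1 \<le> c\<^sup>2" using c by (simp add: power2_eq_square) (metis mult_mono' mult_1 zero_le_one)
  then have y36: "36 \<le> y" using y by linarith
  \<comment> \<open>\<open>D\<close> stars need \<open>D * (r + 1) + 1\<close> nodes;
    \<open>r\<close> is as large as \<open>n\<close> permits, and the rest become pendant
    leaves.\<close>
  define r where "r = (n - 1) div D - 1"
  have n: "n > 0" using y36 D by (cases n) (auto simp: y_def)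
  have "n - 1 < D * ((n - 1) div D + 1)"
    using D dividend_less_times_div[of D "n - 1"] by (simp add: algebra_simps)
  then have "n \<le> D * ((n - 1) div D + 1)" using n by linarith
  then have "real n \<le> real D * (real ((n - 1) div D) + 1)"
    by (metis of_nat_1 of_nat_add of_nat_le_iff of_nat_mult)
  then have "y \<le> real ((n - 1) div D) + 1" using D by (simp add: y_def field_simps)
  then have r_ge: "y - 2 \<le> real r" and r_eq: "(n - 1) div D = r + 1" using y36 by (auto simp: r_def)
  have "D * (r + 1) \<le> n - 1" unfolding r_eq[symmetric] by (rule times_div_less_eq_dividend)
  then obtain z where z: "n - 1 = D * (r + 1) + z" by (metis le_iff_add)
  interpret gadget_chain D 0 0 1 r 0 z
    using r_ge y36 by unfold_locales auto
  have "y \<le> 2 * real r" using r_ge y36 by linarith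
  then have "y / (6 * c) \<le> real ((1 - 0) * r) / (3 * c)"
    using c by (simp add: field_simps)
  moreover have "0 < real r" using \<open>y \<le> 2 * real r\<close> y36 by linarith
  ultimately have "log 2 (y / (6 * c)) \<le> log 2 (real ((1 - 0) * r) / (3 * c))"
    using y36 c by (subst log_le_cancel_iff) auto
  \<comment> \<open>The threshold is \<open>(6 * c)\<^sup>2\<close>, so that losing
    \<open>log 2 (6 * c)\<close> costs at most half of \<open>log 2 y\<close>.\<close>
  moreover have "2 * log 2 (6 * c) = log 2 (36 * c\<^sup>2)"
    using c log_nat_power[of "6 * c" 2 2] by (simp add: power_mult_distrib)
  moreover have "log 2 (36 * c\<^sup>2) \<le> log 2 y"
    using y y36 c by (subst log_le_cancel_iff) auto
  moreover have "log 2 (y / (6 * c)) = log 2 y - log 2 (6 * c)"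
    using y36 c by (subst log_divide) auto
  ultimately have log_ge: "log 2 y / 2 \<le> log 2 (real ((1 - 0) * r) / (3 * c))" by linarith
  \<comment> \<open>Half of the remaining \<open>real D * log 2 y / 2\<close> is at least 1 and pays
    for the rounding.\<close>
  have "log 2 (2 ^ 4) \<le> log 2 y" using y36 by (subst log_le_cancel_iff) auto
  then have "4 \<le> log 2 y" by (subst (asm) log_nat_power) auto
  then have "1 * 4 \<le> real D * log 2 y" using D by (intro mult_mono) auto
  moreover have "real D * (log 2 y / 2) \<le> real D * log 2 (real ((1 - 0) * r) / (3 * c))"
    using log_ge by (intro mult_left_mono) auto
  ultimately have "real D * log 2 y / 4 + 1 \<le> real D * log 2 (real ((1 - 0) * r) / (3 * c))"
    by linarith
  moreover have "C * real D \<le> c * real D" using c by (intro mult_right_mono) auto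
  moreover have "0 \<le> real D * log 2 y / 4" using \<open>1 * 4 \<le> real D * log 2 y\<close> by linarith
  moreover have "n = D * (0 + 1 + r) + 0 + 1 + z" using z n by simp
  ultimately show ?thesis
    unfolding y_def[symmetric] using c(1) by (intro exists_instance_requiring_advice) auto
qed

lemma exists_instance_dense:
  fixes C c a :: real and g :: nat
  assumes c: "c \<ge> 1" "C \<le> c" and g: "48 * c + 1 \<le> real g" and D: "2 * g \<le> D" "2 * D \<le> n"
    and a: "0 \<le> a" "4 * real g * a \<le> real D"
  shows "\<exists>I. valid_instance I \<and> num_nodes I = n \<and> treasure_distance I = ereal (real D) \<and>
     (\<forall>orc. solves_hunt A orc D (C * real D) \<longrightarrow> a \<le> real (length (orc I)))"
proof -
  \<comment> \<open>With \<open>m = 2 * g - 2\<close> a gadget and its path add \<open>2 * g\<close>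
    to the distance but only \<open>4 * g - 2\<close> nodes, so at most \<open>2 * D\<close> nodes
    are needed.\<close>
  define B where "B = D div (2 * g)"
  define e where "e = D mod (2 * g)"
  have g49: "g \<ge> 49" using g c by linarith
  have De: "D = B * (2 * g) + e" unfolding B_def e_def by (rule div_mult_mod_eq[symmetric])
  have e: "e < 2 * g" using g49 by (simp add: e_def)
  have B: "B \<ge> 1" using D(1) g49 by (simp add: B_def div_greater_zero_iff Suc_le_eq)
  have "B * (2 * g) \<ge> 2 * g" using B by simp
  then have "e \<le> B * (2 * g)" using e by linarith
  then have D_le: "D \<le> 4 * g * B" using De by simp
  then have D_le': "real D \<le> 4 * real g * real B" by (metis of_nat_le_iff of_nat_mult of_nat_numeral)
  have "B * (2 * g - 2 + g + g) + 2 * B = B * (2 * g - 2 + g + g + 2)"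
    by (simp add: algebra_simps)
  also have "2 * g - 2 + g + g + 2 = 4 * g" using g49 by simp
  finally have "B * (2 * g - 2 + g + g) + 2 * B = B * (4 * g)" .
  then have "B * (2 * g - 2 + g + g) + e + 1 \<le> 2 * D" using B De by simp
  then obtain z where z: "n = B * (2 * g - 2 + g + g) + e + 1 + z"
    using D(2) by (metis le_iff_add order_trans)
  interpret gadget_chain B "2 * g - 2" 1 g g e z
    using g49 by unfold_locales auto
  \<comment> \<open>Here \<open>\<tau> = 4 * c * g\<close>, as \<open>D \<le> 4 * g * B\<close>. The
    choice of \<open>g\<close> makes each gadget worth two bits, and
    \<open>2 * B \<ge> B + 1 \<ge> a + 1\<close>.\<close>
  have "4 \<le> (real g - 1) / (12 * c)" using g c by (simp add: field_simps)
  also have "\<dots> = real ((g - 1) * g) / (3 * (4 * c * real g))"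
    using g49 c by (simp add: field_simps of_nat_diff)
  finally have "log 2 (2 ^ 2) \<le> log 2 (real ((g - 1) * g) / (3 * (4 * c * real g)))"
    by (subst log_le_cancel_iff) auto
  then have "2 \<le> log 2 (real ((g - 1) * g) / (3 * (4 * c * real g)))"
    by (subst (asm) log_nat_power) auto
  then have "real B * 2 \<le> real B * log 2 (real ((g - 1) * g) / (3 * (4 * c * real g)))"
    by (intro mult_left_mono) auto
  moreover have "4 * real g * a \<le> 4 * real g * real B" using a D_le' by linarith
  then have "a \<le> real B" using g49 by simp
  ultimately have "a + 1 \<le> real B * log 2 (real ((g - 1) * g) / (3 * (4 * c * real g)))"
    using B by linarith
  moreover have "C * real D \<le> (4 * c * real g) * real B"
  proof -
    have "C * real D \<le> c * real D" using c by (intro mult_right_mono) auto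
    also have "\<dots> \<le> c * (4 * real g * real B)" using D_le' c by (intro mult_left_mono) auto
    finally show ?thesis by (simp add: mult_ac)
  qed
  moreover have "1 \<le> 4 * c * real g"
    using c g49 mult_mono[of 1 c 1 "4 * real g"] by (simp add: mult_ac)
  moreover have "2 * g - 2 + 1 + 1 = 2 * g" using g49 by simp
  then have "D = B * (2 * g - 2 + 1 + 1) + e" using De by simp
  ultimately show ?thesis
    using a(1) z by (intro exists_instance_requiring_advice) auto
qed

theorem theorem2:
  shows "\<forall>C>0::real. \<exists>c>0::real. \<exists>n0::nat. \<forall>n D :: nat. \<forall>A :: algorithm.
    n \<ge> n0 \<longrightarrow> D > 0 \<longrightarrow> real D \<le> real n / 2 \<longrightarrow>
    (\<exists>orc. solves_hunt A orc D (C * real D)) \<longrightarrow>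
    (\<exists>I. valid_instance I \<and> num_nodes I = n \<and> treasure_distance I = ereal (real D) \<and>
       (\<forall>orc. solves_hunt A orc D (C * real D) \<longrightarrow>
          real (length (orc I)) \<ge> c * (real D * log 2 (real n / real D))))"
proof (intro allI impI)
  fix C :: real
  assume "C > 0"
  define b where "b = max C 1"
  have b: "b \<ge> 1" "C \<le> b" by (auto simp: b_def)
  define g where "g = nat \<lceil>48 * b + 1\<rceil>"
  have g: "48 * b + 1 \<le> real g" unfolding g_def by (rule real_nat_ceiling_ge)
  define R where "R = 36 * b\<^sup>2"
  have "1 \<le> b\<^sup>2" using b by simp
  then have R: "R \<ge> 36" by (simp add: R_def)
  have "log 2 2 \<le> log 2 R" using R by (subst log_le_cancel_iff) auto
  then have logR: "1 \<le> log 2 R" by simp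
  \<comment> \<open>In the dense case, where \<open>n / D < R\<close>, this makes the claimed bound
    at most \<open>D / (4 * g)\<close>; it also satisfies \<open>c \<le> 1 / 4\<close> for the
    sparse case.\<close>
  define c where "c = 1 / (4 * real g * log 2 R)"
  have "1 * 1 \<le> real g * log 2 R" using g b logR by (intro mult_mono) auto
  then have c: "0 < c" "c \<le> 1 / 4"
    using g b logR by (auto simp: c_def field_simps)
  show "\<exists>c>0. \<exists>n0. \<forall>n D A. n \<ge> n0 \<longrightarrow> D > 0 \<longrightarrow> real D \<le> real n / 2 \<longrightarrow>
    (\<exists>orc. solves_hunt A orc D (C * real D)) \<longrightarrow>
    (\<exists>I. valid_instance I \<and> num_nodes I = n \<and> treasure_distance I = ereal (real D) \<and>
       (\<forall>orc. solves_hunt A orc D (C * real D) \<longrightarrow>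
          real (length (orc I)) \<ge> c * (real D * log 2 (real n / real D))))"
  \<comment> \<open>This \<open>n0\<close> ensures that \<open>n < R * D\<close> implies
    \<open>D > 2 * g\<close>, so at least one dense gadget fits.\<close>
  proof (intro exI[of _ c] exI[of _ "nat \<lceil>R * (2 * real g)\<rceil>"] conjI allI impI)
    fix n D :: nat and A :: algorithm
    assume n: "n \<ge> nat \<lceil>R * (2 * real g)\<rceil>" and D: "D > 0" "real D \<le> real n / 2"
    have log_nonneg: "0 \<le> log 2 (real n / real D)" using D by (simp add: field_simps)
    have a_nonneg: "0 \<le> c * (real D * log 2 (real n / real D))" using c log_nonneg by simp
    show "\<exists>I. valid_instance I \<and> num_nodes I = n \<and> treasure_distance I = ereal (real D) \<and>
       (\<forall>orc. solves_hunt A orc D (C * real D) \<longrightarrow>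
          c * (real D * log 2 (real n / real D)) \<le> real (length (orc I)))"
    proof (cases "R * real D \<le> real n")
      case True
      have "c * (real D * log 2 (real n / real D)) \<le> 1 / 4 * (real D * log 2 (real n / real D))"
        using c log_nonneg by (intro mult_right_mono) auto
      then show ?thesis
        using exists_instance_sparse[OF b D(1), of n A] True unfolding R_def by fastforce
    next
      case False
      have "R * (2 * real g) \<le> real n" using n by linarith
      then have "R * (2 * real g) < R * real D" using False by linarith
      then have "2 * g \<le> D" using R by simp
      have "log 2 (real n / real D) \<le> log 2 R"
        using False D R by (subst log_le_cancel_iff) (auto simp: field_simps)
      then have "4 * real g * (c * (real D * log 2 (real n / real D))) \<le> 4 * real g * (c * (real D * log 2 R))"
        using c by (intro mult_left_mono) auto
      also have "\<dots> = real D" using g b logR by (simp add: c_def)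
      finally show ?thesis
        using exists_instance_dense[OF b g \<open>2 * g \<le> D\<close> _ a_nonneg] D(2) by auto
    qed
  qed (use c in auto)
qed

end
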